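(* For any graph $H$ without isolated vertices on $k\geq 1$ edges, with chromatic index $\chi'$ and vertex cover number $\tau$, $$\frac{k^2}{4\chi'} \leq \frac{w_{\max}(H)}{2} \leq AR_{FF}(H) \leq 2\,w_{\mathrm{greedy}}(H) \leq (\tau+1)k.$$
   Context: All graphs are finite and simple; colors are natural numbers $1,2,\ldots$. An edge-coloring is proper if adjacent edges receive distinct colors; an edge-colored graph is rainbow if all its edges have distinct colors, and a rainbow coloring of $H$ is an edge-coloring of $H$ by natural numbers in which all edges have distinct colors. A copy of $H$ is a (not necessarily induced) subgraph isomorphic to $H$. The chromatic index is the smallest number of colors in a proper edge-coloring; the vertex cover number is the smallest size of a set of vertices meeting every edge. $AR_{FF}(H)$ (First-Fit anti-Ramsey number): Builder presents vertices and edges of a simple graph, one edge at a time, and each new edge is immediately colored by Painter with the smallest color in $\{1,2,\ldots\}$ not used on an adjacent edge already presented (First-Fit). $AR_{FF}(H)$ is the smallest $t$ such that Builder can present $t$ edges so that the resulting colored graph contains a rainbow copy of $H$. The weight of a matching $M$ with respect to an edge-coloring $c$ is $\sum_{e\in M} c(e)$. A maximum matching for $c$ is a matching of largest weight with respect to $c$. A greedy matching for $c$ is a matching constructed by repeatedly taking an edge of highest color that is not adjacent to (and distinct from) any edge already picked, until no such edge remains; for a rainbow coloring $c$ it is unique. Define $$w_{\max}(H) = \min_{c}\ \sum_{e\in M} c(e),\quad M \text{ a maximum matching for } c,$$ $$w_{\mathrm{greedy}}(H) = \min_{c}\ \sum_{e\in M} c(e),\quad M \text{ the greedy matching for } c,$$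 where both minima are over all rainbow colorings $c$ of $H$. *)

theory Defs
  imports Complex_Main
begin

text \<open>
  A graph is given by its vertex set and its set of edges, an edge being a two-element set of
  vertices.
\<close>

definition simple_graph :: "'a set \<Rightarrow> 'a set set \<Rightarrow> bool" where
  "simple_graph V E \<longleftrightarrow> finite V \<and> (\<forall>e\<in>E. e \<subseteq> V \<and> card e = 2)"

definition no_isolated_vertices :: "'a set \<Rightarrow> 'a set set \<Rightarrow> bool" where
  "no_isolated_vertices V E \<longleftrightarrow> (\<forall>v\<in>V. \<exists>e\<in>E. v \<in> e)"

definition adjacent :: "'a set \<Rightarrow> 'a set \<Rightarrow> bool" where
  "adjacent e f \<longleftrightarrow> e \<noteq> f \<and> e \<inter> f \<noteq> {}"

definition vertex_cover :: "'a set \<Rightarrow> 'a set set \<Rightarrow> 'a set \<Rightarrow> bool" where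
  "vertex_cover V E S \<longleftrightarrow> S \<subseteq> V \<and> (\<forall>e\<in>E. S \<inter> e \<noteq> {})"

definition vertex_cover_number :: "'a set \<Rightarrow> 'a set set \<Rightarrow> nat" where
  "vertex_cover_number V E = (LEAST n. \<exists>S. vertex_cover V E S \<and> card S = n)"

text \<open>
  Colors are the positive natural numbers. Colorings are total functions on sets of vertices, and
  only their values on the edge set matter.
\<close>

definition edge_coloring :: "'a set set \<Rightarrow> ('a set \<Rightarrow> nat) \<Rightarrow> bool" where
  "edge_coloring E c \<longleftrightarrow> (\<forall>e\<in>E. 1 \<le> c e)"

definition proper_edge_coloring :: "'a set set \<Rightarrow> ('a set \<Rightarrow> nat) \<Rightarrow> bool" where
  "proper_edge_coloring E c \<longleftrightarrow>
     edge_coloring E c \<and> (\<forall>e\<in>E. \<forall>f\<in>E. adjacent e f \<longrightarrow> c e \<noteq> c f)"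

definition rainbow_coloring :: "'a set set \<Rightarrow> ('a set \<Rightarrow> nat) \<Rightarrow> bool" where
  "rainbow_coloring E c \<longleftrightarrow> edge_coloring E c \<and> inj_on c E"

definition chromatic_index :: "'a set set \<Rightarrow> nat" where
  "chromatic_index E = (LEAST n. \<exists>c. proper_edge_coloring E c \<and> card (c ` E) = n)"

definition matching :: "'a set set \<Rightarrow> 'a set set \<Rightarrow> bool" where
  "matching E M \<longleftrightarrow> M \<subseteq> E \<and> (\<forall>e\<in>M. \<forall>f\<in>M. \<not> adjacent e f)"

definition weight :: "('a set \<Rightarrow> nat) \<Rightarrow> 'a set set \<Rightarrow> nat" where
  "weight c M = (\<Sum>e\<in>M. c e)"

definition maximum_matching :: "'a set set \<Rightarrow> ('a set \<Rightarrow> nat) \<Rightarrow> 'a set set \<Rightarrow> bool" where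
  "maximum_matching E c M \<longleftrightarrow>
     matching E M \<and> (\<forall>M'. matching E M' \<longrightarrow> weight c M' \<le> weight c M)"

definition available :: "'a set set \<Rightarrow> 'a set set \<Rightarrow> 'a set set" where
  "available E M = {e \<in> E. e \<notin> M \<and> (\<forall>f\<in>M. \<not> adjacent e f)}"

text \<open>The sets of edges that can have been picked after some number of greedy steps.\<close>

inductive greedy_picked :: "'a set set \<Rightarrow> ('a set \<Rightarrow> nat) \<Rightarrow> 'a set set \<Rightarrow> bool"
  for E :: "'a set set" and c :: "'a set \<Rightarrow> nat" where
  start: "greedy_picked E c {}"
| pick: "greedy_picked E c M \<Longrightarrow> e \<in> available E M \<Longrightarrow> (\<forall>f\<in>available E M. c f \<le> c e)
    \<Longrightarrow> greedy_picked E c (insert e M)"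

definition greedy_matching :: "'a set set \<Rightarrow> ('a set \<Rightarrow> nat) \<Rightarrow> 'a set set \<Rightarrow> bool" where
  "greedy_matching E c M \<longleftrightarrow> greedy_picked E c M \<and> available E M = {}"

definition w_max :: "'a set set \<Rightarrow> nat" where
  "w_max E = (LEAST w. \<exists>c M. rainbow_coloring E c \<and> maximum_matching E c M \<and> w = weight c M)"

definition w_greedy :: "'a set set \<Rightarrow> nat" where
  "w_greedy E = (LEAST w. \<exists>c M. rainbow_coloring E c \<and> greedy_matching E c M \<and> w = weight c M)"

definition subgraph :: "'a set \<Rightarrow> 'a set set \<Rightarrow> 'a set \<Rightarrow> 'a set set \<Rightarrow> bool" where
  "subgraph V' E' V E \<longleftrightarrow> simple_graph V' E' \<and> V' \<subseteq> V \<and> E' \<subseteq> E"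

definition isomorphic :: "'a set \<Rightarrow> 'a set set \<Rightarrow> 'b set \<Rightarrow> 'b set set \<Rightarrow> bool" where
  "isomorphic V E V' E' \<longleftrightarrow> (\<exists>\<phi>. bij_betw \<phi> V V' \<and> E' = (\<lambda>e. \<phi> ` e) ` E)"

definition contains_rainbow_copy ::
    "'b set \<Rightarrow> 'b set set \<Rightarrow> ('b set \<Rightarrow> nat) \<Rightarrow> 'a set \<Rightarrow> 'a set set \<Rightarrow> bool" where
  "contains_rainbow_copy W F c V E \<longleftrightarrow>
     (\<exists>V' E'. subgraph V' E' W F \<and> isomorphic V E V' E' \<and> rainbow_coloring E' c)"

text \<open>
  The list \<open>es\<close> contains the edges in the order of their presentation. The condition below
  determines \<open>c\<close> uniquely on \<open>set es\<close>.
\<close>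

definition first_fit_coloring :: "'a set list \<Rightarrow> ('a set \<Rightarrow> nat) \<Rightarrow> bool" where
  "first_fit_coloring es c \<longleftrightarrow>
     (\<forall>i<length es. c (es ! i) =
        (LEAST k. 1 \<le> k \<and> (\<forall>j<i. adjacent (es ! j) (es ! i) \<longrightarrow> c (es ! j) \<noteq> k)))"

text \<open>
  As Painter is deterministic, a strategy of Builder amounts to a finite vertex set and a sequence
  of distinct edges on it. Taking natural numbers as vertices is no restriction,
  since the presented graph is finite.
\<close>

definition AR_FF :: "'a set \<Rightarrow> 'a set set \<Rightarrow> nat" where
  "AR_FF V E = (LEAST t. \<exists>(W :: nat set) es c.
     simple_graph W (set es) \<and> distinct es \<and> length es = t \<and>
     first_fit_coloring es c \<and> contains_rainbow_copy W (set es) c V E)"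

end

theory Submission
  imports Defs
begin

text \<open>
  The first bound splits the total color of a rainbow coloring, at least \<open>k\<^sup>2 / 2\<close>,
  into \<open>\<chi>'\<close> matchings. For the second, an edge of First-Fit color \<open>i\<close> meets at least \<open>i\<close> edges
  (itself included), while every edge meets at most two edges of a matching. For the third, every
  edge meets an edge of the greedy matching of at least its color; so attaching to both ends of
  each greedy edge of color \<open>i\<close> pendant edges of those colors below \<open>i\<close> that are missing there
  gives a graph whose First-Fit coloring, with the edges presented by increasing color, extends the
  given one. For the last, assign to each edge an index \<open>g e\<close> in \<open>{1..\<tau>}\<close> of a cover vertex on it
  and color by decreasing \<open>g\<close>: every matching then weighs at most the sum of \<open>g\<close>. Since
  \<open>g\<close> and \<open>\<tau> + 1 - g\<close> sum up to \<open>(\<tau> + 1) k\<close>, one of the two will do.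
\<close>

section \<open>Rainbow colorings, maximum matchings and greedy matchings\<close>

lemma simple_graph_finite_edges:
  assumes "simple_graph V E"
  shows "finite E"
  using assms by (intro finite_subset[of E "Pow V"]) (auto simp: simple_graph_def)

text \<open>List the edges by decreasing \<open>g\<close> and color each by its position: all edges
  up to that position have at least the same \<open>g\<close>.\<close>

lemma rainbow_coloring_le_ex:
  fixes g :: "'a set \<Rightarrow> nat"
  assumes "finite E"
  shows "\<exists>c. rainbow_coloring E c \<and> (\<forall>e\<in>E. c e \<le> card {f\<in>E. g e \<le> g f})"
  using assms
\<comment> \<open>The rule inserts elements in increasing order of the ranking function; negating
  \<open>g\<close> makes each new edge one of smallest \<open>g\<close>, which then takes the next
  color \<open>Suc (card S)\<close>.\<close>
proof (induction rule: finite_ranking_induct[where f = "\<lambda>e. - int (g e)"])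
  case empty
  then show ?case by (simp add: rainbow_coloring_def edge_coloring_def)
next
  case (insert x S)
  then obtain c where c: "rainbow_coloring S c" "\<And>e. e \<in> S \<Longrightarrow> c e \<le> card {f\<in>S. g e \<le> g f}"
    by blast
  have le: "c e \<le> card S" if "e \<in> S" for e
  proof -
    have "card {f\<in>S. g e \<le> g f} \<le> card S"
      by (rule card_mono) (use insert.hyps in auto)
    with c(2)[OF that] show ?thesis by linarith
  qed
  have new: "c e \<noteq> Suc (card S)" if "e \<in> S" for e
    using le[OF that] by linarith
  show ?case
  proof (cases "x \<in> S")
    case True
    then show ?thesis using c by (auto simp: insert_absorb)
  next
    case False
    define d where "d = c(x := Suc (card S))"
    have dS: "d e = c e" if "e \<in> S" for e using that False by (auto simp: d_def)
    have "inj_on d S" using c(1) dS by (simp add: rainbow_coloring_def inj_on_def)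
    moreover have "d x \<notin> d ` S"
    proof
      assume "d x \<in> d ` S"
      then obtain e where "e \<in> S" "d x = d e" by blast
      then show False using new[of e] dS[of e] by (simp add: d_def)
    qed
    ultimately have "inj_on d (insert x S)" using False by simp
    moreover have "edge_coloring (insert x S) d"
      using c(1) dS by (auto simp: rainbow_coloring_def edge_coloring_def d_def)
    moreover have "d e \<le> card {f\<in>insert x S. g e \<le> g f}" if "e \<in> insert x S" for e
    proof (cases "e = x")
      case True
      have "{f\<in>insert x S. g x \<le> g f} = insert x S" using insert.hyps by force
      then show ?thesis using True False insert.hyps by (simp add: d_def)
    next
      case False
      then have "e \<in> S" using that by simp
      have "d e \<le> card {f\<in>S. g e \<le> g f}" using dS c(2) \<open>e \<in> S\<close> by simp
      also have "\<dots> \<le> card {f\<in>insert x S. g e \<le> g f}"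
        by (rule card_mono) (use insert.hyps in auto)
      finally show ?thesis .
    qed
    ultimately show ?thesis unfolding rainbow_coloring_def by blast
  qed
qed

lemma rainbow_coloring_ex: "finite E \<Longrightarrow> \<exists>c. rainbow_coloring E c"
  using rainbow_coloring_le_ex by blast

lemma rainbow_imp_proper: "rainbow_coloring E c \<Longrightarrow> proper_edge_coloring E c"
  by (auto simp: rainbow_coloring_def proper_edge_coloring_def adjacent_def inj_on_def)

text \<open>The largest of n distinct positive integers is at least n. Adding the elements by
  increasing value thus raises the sum by at least n at the n-th step.\<close>

lemma card_squared_le_sum_inj_pos:
  fixes c :: "'b \<Rightarrow> nat"
  assumes "finite A" "inj_on c A" "\<forall>x\<in>A. 1 \<le> c x"
  shows "(card A)\<^sup>2 \<le> 2 * (\<Sum>x\<in>A. c x)"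
  using assms
proof (induction rule: finite_ranking_induct[where f = c])
  case empty
  then show ?case by simp
next
  case (insert x S)
  show ?case
  proof (cases "x \<in> S")
    case True
    then show ?thesis using insert by (simp add: insert_absorb)
  next
    case False
    have "card (insert x S) = card (c ` insert x S)"
      using insert.prems by (metis card_image)
    also have "\<dots> \<le> card {1..c x}"
      by (rule card_mono) (use insert in auto)
    finally have "Suc (card S) \<le> c x" using False insert.hyps by simp
    moreover have "(card S)\<^sup>2 \<le> 2 * (\<Sum>x\<in>S. c x)" using insert by auto
    ultimately show ?thesis
      using False insert.hyps by (simp add: power2_eq_square)
  qed
qed

lemma finite_maximizer_ex:
  fixes f :: "'b \<Rightarrow> nat"
  assumes "finite A" "A \<noteq> {}"
  shows "\<exists>x\<in>A. \<forall>y\<in>A. f y \<le> f x"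
proof -
  have "Max (f ` A) \<in> f ` A" using assms by (intro Max_in) auto
  then obtain x where "x \<in> A" "Max (f ` A) = f x" by blast
  then show ?thesis using assms(1) by (metis Max_ge finite_imageI imageI)
qed

lemma maximum_matching_ex:
  assumes "finite E"
  shows "\<exists>M. maximum_matching E c M"
proof -
  have "finite {M. matching E M}"
    by (rule finite_subset[of _ "Pow E"]) (use assms in \<open>auto simp: matching_def\<close>)
  moreover have "{} \<in> {M. matching E M}" by (simp add: matching_def)
  ultimately have "\<exists>M\<in>{M. matching E M}. \<forall>M'\<in>{M. matching E M}. weight c M' \<le> weight c M"
    by (intro finite_maximizer_ex) blast+
  then show ?thesis by (auto simp: maximum_matching_def)
qed

lemma greedy_picked_matching:
  assumes "greedy_picked E c M"
  shows "matching E M"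
  using assms
proof induction
  case start
  then show ?case by (simp add: matching_def)
next
  case (pick M e)
  then show ?case
    by (auto simp: matching_def available_def adjacent_def)
qed

text \<open>When an edge stops being available, the edge just picked meets it and was chosen with
  highest color among the available ones, this edge included. Nonemptiness makes a picked edge meet
  itself.\<close>

lemma greedy_picked_dominates:
  assumes "greedy_picked E c M" "\<forall>e\<in>E. e \<noteq> {}" "f \<in> E"
  shows "f \<in> available E M \<or> (\<exists>m\<in>M. f \<inter> m \<noteq> {} \<and> c f \<le> c m)"
  using assms
proof induction
  case start
  then show ?case by (simp add: available_def)
next
  case (pick M e)
  then show ?case
    by (cases "f \<in> available E M") (auto simp: available_def adjacent_def)
qed

text \<open>An inclusion-maximal set of greedily picked edges leaves nothing available, since one
  more pick would enlarge it.\<close>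

lemma greedy_matching_ex:
  assumes "finite E"
  shows "\<exists>M. greedy_matching E c M"
proof -
  have "finite {M. greedy_picked E c M}"
    by (rule finite_subset[of _ "Pow E"])
      (use assms greedy_picked_matching in \<open>auto simp: matching_def\<close>)
  moreover have "{M. greedy_picked E c M} \<noteq> {}" using greedy_picked.start by blast
  ultimately obtain M where M: "greedy_picked E c M"
    and max: "\<And>N. greedy_picked E c N \<Longrightarrow> M \<subseteq> N \<Longrightarrow> M = N"
    using finite_has_maximal by (metis mem_Collect_eq)
  have "available E M = {}"
  proof (rule ccontr)
    assume ne: "available E M \<noteq> {}"
    have "finite (available E M)" using assms by (simp add: available_def)
    with ne obtain e where e: "e \<in> available E M" "\<forall>f\<in>available E M. c f \<le> c e"
      using finite_maximizer_ex[of "available E M" c] by blast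
    have "M = insert e M" using max[OF greedy_picked.pick[OF M e]] by blast
    then show False using e(1) by (auto simp: available_def)
  qed
  then show ?thesis using M by (auto simp: greedy_matching_def)
qed

lemma w_max_attained:
  assumes "finite E"
  shows "\<exists>c M. rainbow_coloring E c \<and> maximum_matching E c M \<and> w_max E = weight c M"
proof -
  have "\<exists>w c M. rainbow_coloring E c \<and> maximum_matching E c M \<and> w = weight c M"
    using rainbow_coloring_ex maximum_matching_ex assms by blast
  then show ?thesis unfolding w_max_def by (rule LeastI_ex)
qed

lemma w_greedy_attained:
  assumes "finite E"
  shows "\<exists>c M. rainbow_coloring E c \<and> greedy_matching E c M \<and> w_greedy E = weight c M"
proof -
  have "\<exists>w c M. rainbow_coloring E c \<and> greedy_matching E c M \<and> w = weight c M"
    using rainbow_coloring_ex greedy_matching_ex assms by blast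
  then show ?thesis unfolding w_greedy_def by (rule LeastI_ex)
qed

section \<open>Lower bound on \<open>w_max\<close> by the chromatic index\<close>

text \<open>The classes of an optimal proper coloring \<open>p\<close> are matchings, while a
  rainbow coloring \<open>c\<close> attaining \<open>w_max E\<close> supplies the weights, so no
  class weighs more than \<open>w_max E\<close>.\<close>

lemma card_squared_le_chromatic_index_w_max:
  assumes "finite E"
  shows "(card E)\<^sup>2 \<le> 2 * chromatic_index E * w_max E"
proof -
  have "\<exists>n c. proper_edge_coloring E c \<and> card (c ` E) = n"
    using rainbow_coloring_ex[OF assms] rainbow_imp_proper by blast
  then have "\<exists>c. proper_edge_coloring E c \<and> card (c ` E) = chromatic_index E"
    unfolding chromatic_index_def by (rule LeastI_ex)
  then obtain p where p: "proper_edge_coloring E p" "card (p ` E) = chromatic_index E" by blast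
  obtain c M where c: "rainbow_coloring E c" and M: "maximum_matching E c M"
    and w: "w_max E = weight c M"
    using w_max_attained[OF assms] by blast
  have "(\<Sum>e\<in>E. c e) = (\<Sum>i\<in>p ` E. weight c {e\<in>E. p e = i})"
    unfolding weight_def by (rule sum.image_gen[OF assms])
  also have "\<dots> \<le> (\<Sum>i\<in>p ` E. w_max E)"
  proof (rule sum_mono)
    fix i
    have "matching E {e\<in>E. p e = i}"
      using p(1) by (auto simp: matching_def proper_edge_coloring_def) metis
    then show "weight c {e\<in>E. p e = i} \<le> w_max E"
      using M w by (simp add: maximum_matching_def)
  qed
  also have "\<dots> = chromatic_index E * w_max E" using p(2) by simp
  finally have "(\<Sum>e\<in>E. c e) \<le> chromatic_index E * w_max E" .
  moreover have "(card E)\<^sup>2 \<le> 2 * (\<Sum>e\<in>E. c e)"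
    by (rule card_squared_le_sum_inj_pos)
      (use assms c in \<open>auto simp: rainbow_coloring_def edge_coloring_def\<close>)
  ultimately show ?thesis by linarith
qed

section \<open>Matchings in First-Fit colored graphs\<close>

text \<open>Each color below \<open>c e\<close> was blocked by an earlier adjacent edge, and
  \<open>e\<close> itself carries \<open>c e\<close>. Hence all of \<open>{1..c e}\<close> occurs on
  edges meeting \<open>e\<close>.\<close>

lemma first_fit_color_le_card_meeting:
  assumes ff: "first_fit_coloring es c" and e: "e \<in> set es" "e \<noteq> {}"
  shows "c e \<le> card {f \<in> set es. f \<inter> e \<noteq> {}}"
proof -
  obtain i where i: "i < length es" "e = es ! i" using e by (metis in_set_conv_nth)
  have ce: "c e = (LEAST k. 1 \<le> k \<and> (\<forall>j<i. adjacent (es ! j) e \<longrightarrow> c (es ! j) \<noteq> k))"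
    using ff i unfolding first_fit_coloring_def by blast
  have "{1..c e} \<subseteq> c ` {f \<in> set es. f \<inter> e \<noteq> {}}"
  proof
    fix k assume k: "k \<in> {1..c e}"
    show "k \<in> c ` {f \<in> set es. f \<inter> e \<noteq> {}}"
    proof (cases "k = c e")
      case True
      then show ?thesis using e by blast
    next
      case False
      then have "k < c e" using k by simp
      then have "\<not> (1 \<le> k \<and> (\<forall>j<i. adjacent (es ! j) e \<longrightarrow> c (es ! j) \<noteq> k))"
        unfolding ce by (rule not_less_Least)
      then obtain j where "j < i" "adjacent (es ! j) e" "c (es ! j) = k" using k by auto
      then show ?thesis using i by (force simp: adjacent_def)
    qed
  qed
  then have "card {1..c e} \<le> card (c ` {f \<in> set es. f \<inter> e \<noteq> {}})"
    by (intro card_mono) auto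
  also have "\<dots> \<le> card {f \<in> set es. f \<inter> e \<noteq> {}}" by (rule card_image_le) auto
  finally show ?thesis by simp
qed

text \<open>Edges of a matching are disjoint, so choosing a common vertex with \<open>f\<close> for
  each of them is injective.\<close>

lemma card_matching_meeting_le:
  assumes "matching E M" "finite f"
  shows "card {e\<in>M. f \<inter> e \<noteq> {}} \<le> card f"
proof (rule card_inj_on_le)
  define v where "v e = (SOME x. x \<in> f \<inter> e)" for e
  have v: "v e \<in> f \<inter> e" if "f \<inter> e \<noteq> {}" for e
    unfolding v_def using that by (metis all_not_in_conv someI_ex)
  show "v ` {e\<in>M. f \<inter> e \<noteq> {}} \<subseteq> f" using v by blast
  show "inj_on v {e\<in>M. f \<inter> e \<noteq> {}}"
  proof (rule inj_onI)
    fix x y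
    assume x: "x \<in> {e\<in>M. f \<inter> e \<noteq> {}}" and y: "y \<in> {e\<in>M. f \<inter> e \<noteq> {}}" and eq: "v x = v y"
    have "v x \<in> x \<inter> y" using v[of x] v[of y] x y eq by simp
    moreover have "\<not> adjacent x y" using assms x y by (simp add: matching_def)
    ultimately show "x = y" by (auto simp: adjacent_def)
  qed
qed (use assms in auto)

lemma first_fit_matching_weight_le:
  assumes W: "simple_graph W (set es)" and "distinct es" and ff: "first_fit_coloring es c"
    and M: "matching (set es) M"
  shows "weight c M \<le> 2 * length es"
proof -
  have card2: "card e = 2" if "e \<in> set es" for e using W that by (simp add: simple_graph_def)
  have fM: "finite M" and sub: "M \<subseteq> set es"
    using M finite_subset by (auto simp: matching_def)
  have "weight c M \<le> (\<Sum>e\<in>M. card {f \<in> set es. f \<inter> e \<noteq> {}})"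
    unfolding weight_def
  proof (rule sum_mono)
    fix e assume "e \<in> M"
    then have "e \<in> set es" "e \<noteq> {}" using sub card2[of e] by auto
    then show "c e \<le> card {f \<in> set es. f \<inter> e \<noteq> {}}"
      by (rule first_fit_color_le_card_meeting[OF ff])
  qed
  \<comment> \<open>Double counting of the pairs of an edge of \<open>M\<close> and a presented edge
    meeting it.\<close>
  also have "\<dots> = (\<Sum>f\<in>set es. card {e\<in>M. f \<inter> e \<noteq> {}})"
    by (rule sum_multicount_gen) (use fM in auto)
  also have "\<dots> \<le> (\<Sum>f\<in>set es. 2)"
  proof (rule sum_mono)
    fix f assume "f \<in> set es"
    then have "card f = 2" "finite f" using card2[of f] by (auto intro: card_ge_0_finite)
    then show "card {e\<in>M. f \<inter> e \<noteq> {}} \<le> 2" using card_matching_meeting_le[OF M] by metis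
  qed
  also have "\<dots> = 2 * length es" using distinct_card[OF \<open>distinct es\<close>] by simp
  finally show ?thesis .
qed

text \<open>Pulled back along \<open>\<phi>\<close>, the colors of the copy form a rainbow coloring
  of \<open>E\<close>. Its maximum matching weighs at least \<open>w_max E\<close> and maps to a
  matching of the same weight among the presented edges.\<close>

lemma w_max_le_first_fit:
  assumes G: "simple_graph V E" and W: "simple_graph W (set es)" and d: "distinct es"
    and ff: "first_fit_coloring es c" and copy: "contains_rainbow_copy W (set es) c V E"
  shows "w_max E \<le> 2 * length es"
proof -
  obtain V' E' \<phi> where sub: "subgraph V' E' W (set es)" and bij: "bij_betw \<phi> V V'"
    and E': "E' = (\<lambda>e. \<phi> ` e) ` E" and rb: "rainbow_coloring E' c"
    using copy unfolding contains_rainbow_copy_def isomorphic_def by blast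
  have EV: "e \<subseteq> V" if "e \<in> E" for e using G that by (simp add: simple_graph_def)
  have inj: "inj_on \<phi> V" using bij by (simp add: bij_betw_def)
  have injE: "inj_on ((`) \<phi>) E"
    using inj_on_image_Pow[OF inj] EV by (auto intro: inj_on_subset)
  have "finite E" using G by (rule simple_graph_finite_edges)
  have rb': "rainbow_coloring E (\<lambda>e. c (\<phi> ` e))"
    using rb injE unfolding E' rainbow_coloring_def edge_coloring_def
    by (auto simp: inj_on_def)
  obtain M where M: "maximum_matching E (\<lambda>e. c (\<phi> ` e)) M"
    using maximum_matching_ex[OF \<open>finite E\<close>] by blast
  then have mM: "matching E M" by (simp add: maximum_matching_def)
  then have "M \<subseteq> E" by (simp add: matching_def)
  have "w_max E \<le> weight (\<lambda>e. c (\<phi> ` e)) M"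
    unfolding w_max_def by (rule Least_le) (use rb' M in blast)
  also have "\<dots> = weight c ((`) \<phi> ` M)"
    unfolding weight_def by (subst sum.reindex) (use injE \<open>M \<subseteq> E\<close> in \<open>auto intro: inj_on_subset\<close>)
  also have "\<dots> \<le> 2 * length es"
  proof (rule first_fit_matching_weight_le[OF W d ff])
    have "\<not> adjacent (\<phi> ` e) (\<phi> ` f)" if "e \<in> M" "f \<in> M" for e f
    proof -
      have "e \<subseteq> V" "f \<subseteq> V" using that \<open>M \<subseteq> E\<close> EV by auto
      then have "\<phi> ` e \<inter> \<phi> ` f = \<phi> ` (e \<inter> f)" using inj_on_image_Int[OF inj] by metis
      moreover have "\<not> adjacent e f" using mM that by (simp add: matching_def)
      ultimately show ?thesis by (auto simp: adjacent_def)
    qed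
    moreover have "(`) \<phi> ` M \<subseteq> set es"
      using sub \<open>M \<subseteq> E\<close> by (auto simp: subgraph_def E')
    ultimately show "matching (set es) ((`) \<phi> ` M)" by (auto simp: matching_def)
  qed
  finally show ?thesis .
qed

section \<open>Grundy colorings as First-Fit colorings\<close>

text \<open>The edge version of Grundy colorings: an order-free description of what First-Fit can
  produce, which can be checked without naming a presentation order.\<close>

definition grundy_coloring :: "'a set set \<Rightarrow> ('a set \<Rightarrow> nat) \<Rightarrow> bool" where
  "grundy_coloring F C \<longleftrightarrow> proper_edge_coloring F C \<and>
     (\<forall>e\<in>F. \<forall>k. 1 \<le> k \<and> k < C e \<longrightarrow> (\<exists>f\<in>F. adjacent f e \<and> C f = k))"

text \<open>Present the edges by increasing color. A smaller color is then blocked by an adjacent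
  edge already presented, and properness keeps the edge's own color free.\<close>

lemma grundy_coloring_first_fit:
  assumes "finite F" and C: "grundy_coloring F C"
  shows "\<exists>es. set es = F \<and> distinct es \<and> first_fit_coloring es C"
proof -
  obtain xs where xs: "set xs = F" "distinct xs" using finite_distinct_list[OF assms(1)] by blast
  define es where "es = sort_key C xs"
  have es: "set es = F" "distinct es" and sorted: "sorted (map C es)"
    using xs by (auto simp: es_def)
  have "first_fit_coloring es C"
    unfolding first_fit_coloring_def
  proof (intro allI impI, rule Least_equality[symmetric])
    fix i assume i: "i < length es"
    then have iF: "es ! i \<in> F" using es(1) nth_mem by blast
    have jF: "es ! j \<in> F" if "j < i" for j using that i es(1) nth_mem[of j es] by simp
    show "1 \<le> C (es ! i) \<and> (\<forall>j<i. adjacent (es ! j) (es ! i) \<longrightarrow> C (es ! j) \<noteq> C (es ! i))"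
      using C iF jF by (auto simp: grundy_coloring_def proper_edge_coloring_def edge_coloring_def)
    fix k assume k: "1 \<le> k \<and> (\<forall>j<i. adjacent (es ! j) (es ! i) \<longrightarrow> C (es ! j) \<noteq> k)"
    show "C (es ! i) \<le> k"
    proof (rule ccontr)
      assume "\<not> C (es ! i) \<le> k"
      then have "1 \<le> k \<and> k < C (es ! i)" using k by simp
      then obtain f where f: "f \<in> F" "adjacent f (es ! i)" "C f = k"
        using C iF unfolding grundy_coloring_def by blast
      then obtain j where j: "j < length es" "es ! j = f" using es(1) by (metis in_set_conv_nth)
      have "j < i"
      proof (rule ccontr)
        assume "\<not> j < i"
        then have "C (es ! i) \<le> C (es ! j)"
          using sorted_nth_mono[OF sorted, of i j] i j by simp
        then show False using f j \<open>\<not> C (es ! i) \<le> k\<close> by simp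
      qed
      then show False using k f j by blast
    qed
  qed
  then show ?thesis using es by blast
qed

lemma adjacent_image:
  assumes "inj_on \<psi> W" "e \<subseteq> W" "f \<subseteq> W"
  shows "adjacent (\<psi> ` e) (\<psi> ` f) \<longleftrightarrow> adjacent e f"
proof -
  have "\<psi> ` e \<inter> \<psi> ` f = \<psi> ` (e \<inter> f)" using inj_on_image_Int assms by metis
  moreover have "\<psi> ` e = \<psi> ` f \<longleftrightarrow> e = f" using inj_on_image_eq_iff assms by metis
  ultimately show ?thesis by (auto simp: adjacent_def)
qed

lemma simple_graph_image:
  assumes "inj_on \<psi> W" "simple_graph W F"
  shows "simple_graph (\<psi> ` W) ((`) \<psi> ` F)"
proof -
  have "card (\<psi> ` e) = 2" if "e \<in> F" for e
  proof -
    have "e \<subseteq> W" "card e = 2" using assms(2) that by (auto simp: simple_graph_def)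
    then show ?thesis using card_image[OF inj_on_subset[OF assms(1)]] by metis
  qed
  then show ?thesis using assms(2) by (auto simp: simple_graph_def)
qed

text \<open>Builder's vertices are natural numbers, so the graph is moved there along an injection.
  The second claim says that the minimum is attained; it rests on the presentation built here,
  without which \<open>LEAST\<close> would range over an empty set.\<close>

lemma AR_FF_le_grundy:
  fixes W :: "'b set"
  assumes W: "simple_graph W F" and C: "grundy_coloring F C"
    and copy: "contains_rainbow_copy W F C V E"
  shows "AR_FF V E \<le> card F"
    and "\<exists>(W :: nat set) es c. simple_graph W (set es) \<and> distinct es \<and> length es = AR_FF V E \<and>
      first_fit_coloring es c \<and> contains_rainbow_copy W (set es) c V E"
proof -
  have finW: "finite W" and FW: "\<And>e. e \<in> F \<Longrightarrow> e \<subseteq> W" using W by (auto simp: simple_graph_def)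
  have "finite F" using W by (rule simple_graph_finite_edges)
  obtain \<psi> :: "'b \<Rightarrow> nat" where inj: "inj_on \<psi> W"
    using finite_imp_inj_to_nat_seg[OF finW] by blast
  have injF: "inj_on ((`) \<psi>) F"
    using inj_on_image_Pow[OF inj] FW by (auto intro: inj_on_subset)
  \<comment> \<open>\<open>D\<close> reads off the color of the original edge by undoing
    \<open>\<psi>\<close>.\<close>
  define D where "D x = C (inv_into W \<psi> ` x)" for x
  have D: "D (\<psi> ` e) = C e" if "e \<in> F" for e
    using inv_into_image_cancel[OF inj FW[OF that]] by (simp add: D_def)
  have adj: "adjacent (\<psi> ` e) (\<psi> ` f) \<longleftrightarrow> adjacent e f" if "e \<in> F" "f \<in> F" for e f
    using adjacent_image[OF inj] FW that by blast
  let ?F = "(`) \<psi> ` F"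
  have "proper_edge_coloring ?F D"
    using C D adj unfolding grundy_coloring_def proper_edge_coloring_def edge_coloring_def by auto
  moreover have "\<exists>f\<in>?F. adjacent f e \<and> D f = k" if "e \<in> ?F" "1 \<le> k" "k < D e" for e k
  proof -
    obtain e0 where e0: "e0 \<in> F" "e = \<psi> ` e0" using \<open>e \<in> ?F\<close> by blast
    then have "1 \<le> k \<and> k < C e0" using that D by simp
    then obtain f where "f \<in> F" "adjacent f e0" "C f = k"
      using C e0(1) unfolding grundy_coloring_def by blast
    then show ?thesis using e0 D adj by blast
  qed
  ultimately have "grundy_coloring ?F D" by (auto simp: grundy_coloring_def)
  then obtain es where es: "set es = ?F" "distinct es" "first_fit_coloring es D"
    using grundy_coloring_first_fit \<open>finite F\<close> by (metis finite_imageI)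
  have len: "length es = card F"
    using distinct_card[OF es(2)] es(1) card_image[OF injF] by simp
  obtain V' E' \<phi> where sub: "subgraph V' E' W F" and bij: "bij_betw \<phi> V V'"
    and E': "E' = (\<lambda>e. \<phi> ` e) ` E" and rb: "rainbow_coloring E' C"
    using copy unfolding contains_rainbow_copy_def isomorphic_def by blast
  have V'W: "V' \<subseteq> W" and E'F: "E' \<subseteq> F" and gr: "simple_graph V' E'"
    using sub by (auto simp: subgraph_def)
  have injV': "inj_on \<psi> V'" using inj V'W by (rule inj_on_subset)
  have "subgraph (\<psi> ` V') ((`) \<psi> ` E') (\<psi> ` W) (set es)"
    using V'W E'F es(1) simple_graph_image[OF injV' gr] unfolding subgraph_def by blast
  moreover have "isomorphic V E (\<psi> ` V') ((`) \<psi> ` E')"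
    unfolding isomorphic_def
  proof (intro exI conjI)
    show "bij_betw (\<psi> \<circ> \<phi>) V (\<psi> ` V')"
      using bij injV' by (intro bij_betw_trans) (auto simp: bij_betw_def)
    show "(`) \<psi> ` E' = (\<lambda>e. (\<psi> \<circ> \<phi>) ` e) ` E"
      by (auto simp: E' image_comp image_image)
  qed
  moreover have "rainbow_coloring ((`) \<psi> ` E') D"
  proof -
    have "D (\<psi> ` e) = C e" if "e \<in> E'" for e using D E'F that by blast
    then show ?thesis using rb unfolding rainbow_coloring_def edge_coloring_def
      by (auto simp: inj_on_def)
  qed
  ultimately have "contains_rainbow_copy (\<psi> ` W) (set es) D V E"
    unfolding contains_rainbow_copy_def by blast
  moreover have "simple_graph (\<psi> ` W) (set es)"
    using simple_graph_image[OF inj W] es(1) by simp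
  ultimately have ex: "\<exists>(W :: nat set) es c. simple_graph W (set es) \<and> distinct es \<and>
      length es = card F \<and> first_fit_coloring es c \<and> contains_rainbow_copy W (set es) c V E"
    using es len by blast
  then show "AR_FF V E \<le> card F" unfolding AR_FF_def by (rule Least_le)
  show "\<exists>(W :: nat set) es c. simple_graph W (set es) \<and> distinct es \<and> length es = AR_FF V E \<and>
      first_fit_coloring es c \<and> contains_rainbow_copy W (set es) c V E"
    unfolding AR_FF_def by (rule LeastI) (rule ex)
qed

section \<open>Extending a greedily matched graph by pendant edges\<close>

text \<open>Original vertices are tagged \<open>Inl\<close>, new leaves \<open>Inr\<close>; the
  tagged \<open>E\<close> is the rainbow copy. For the size, every edge of \<open>F\<close> has, at
  an end of some greedy edge \<open>m\<close>, a color in \<open>{1..c m}\<close>, and properness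
  allows at most \<open>c m\<close> such edges at each of the two ends.\<close>

lemma grundy_extension_ex:
  fixes V :: "'a set"
  assumes G: "simple_graph V E" and rb: "rainbow_coloring E c" and M: "greedy_matching E c M"
  shows "\<exists>(W :: ('a + 'a \<times> nat) set) F C. simple_graph W F \<and> grundy_coloring F C \<and>
    contains_rainbow_copy W F C V E \<and> card F \<le> 2 * weight c M"
proof -
  have "finite V" and EV: "\<And>e. e \<in> E \<Longrightarrow> e \<subseteq> V" and card2: "\<And>e. e \<in> E \<Longrightarrow> card e = 2"
    using G by (auto simp: simple_graph_def)
  have "finite E" using G by (rule simple_graph_finite_edges)
  have ne: "e \<noteq> {}" if "e \<in> E" for e using card2[OF that] by auto
  have gp: "greedy_picked E c M" and av: "available E M = {}"
    using M by (auto simp: greedy_matching_def)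
  have mM: "matching E M" using gp by (rule greedy_picked_matching)
  have ME: "M \<subseteq> E" using mM by (simp add: matching_def)
  then have "finite M" using \<open>finite E\<close> finite_subset by blast
  have dom: "\<exists>m\<in>M. f \<inter> m \<noteq> {} \<and> c f \<le> c m" if "f \<in> E" for f
    using greedy_picked_dominates[OF gp _ that] ne av by blast
  have pos: "1 \<le> c e" if "e \<in> E" for e
    using rb that by (simp add: rainbow_coloring_def edge_coloring_def)
  have cinj: "e = f" if "e \<in> E" "f \<in> E" "c e = c f" for e f
    using rb that by (simp add: rainbow_coloring_def inj_on_def)
  \<comment> \<open>\<open>(u, j) \<in> P\<close> stands for a pendant edge of color \<open>j\<close> to be attached to \<open>u\<close>, with leaf \<open>Inr (u, j)\<close>.\<close>
  define P where "P = {(u, j). \<exists>m\<in>M. u \<in> m \<and> 1 \<le> j \<and> j < c m \<and> (\<forall>e\<in>E. u \<in> e \<longrightarrow> c e \<noteq> j)}"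
  have "P \<subseteq> V \<times> {..<Suc (\<Sum>m\<in>M. c m)}"
  proof -
    have "c m \<le> (\<Sum>m\<in>M. c m)" if "m \<in> M" for m
      using member_le_sum[OF that, of c] \<open>finite M\<close> by simp
    then show ?thesis using ME EV unfolding P_def by fastforce
  qed
  then have "finite P" and PV: "\<And>u j. (u, j) \<in> P \<Longrightarrow> u \<in> V"
    using \<open>finite V\<close> finite_subset by blast+
  define h :: "'a set \<Rightarrow> ('a + 'a \<times> nat) set" where "h e = Inl ` e" for e
  define pe :: "'a \<times> nat \<Rightarrow> ('a + 'a \<times> nat) set" where "pe p = {Inl (fst p), Inr p}" for p
  define F where "F = h ` E \<union> pe ` P"
  \<comment> \<open>Exactly the pendant edges contain an \<open>Inr\<close> vertex, and this leaf
    stores their color. For any other edge of \<open>F\<close> the preimage under \<open>Inl\<close>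
    recovers the edge of \<open>E\<close>.\<close>
  define C where "C x = (if \<exists>p. Inr p \<in> x then snd (SOME p. Inr p \<in> x) else c (Inl -` x))"
    for x :: "('a + 'a \<times> nat) set"
  define W where "W = Inl ` V \<union> Inr ` P"
  have Ch: "C (h e) = c e" for e
    by (auto simp: C_def h_def inj_vimage_image_eq)
  have Cp: "C (pe p) = snd p" for p
    by (auto simp: C_def pe_def)
  have W: "simple_graph W F"
    using \<open>finite V\<close> \<open>finite P\<close> EV card2 PV unfolding simple_graph_def W_def F_def h_def pe_def
    by (auto simp: card_image)
  \<comment> \<open>At both ends of a greedy edge every smaller color occurs, on an edge of
    \<open>E\<close> or on a pendant edge added for it.\<close>
  have full: "\<exists>f\<in>F. Inl u \<in> f \<and> C f = k" if "m \<in> M" "u \<in> m" "1 \<le> k" "k < c m" for m u k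
  proof (cases "\<exists>e\<in>E. u \<in> e \<and> c e = k")
    case True
    then show ?thesis using Ch by (auto simp: F_def h_def)
  next
    case False
    then have "(u, k) \<in> P" using that by (auto simp: P_def)
    then have "pe (u, k) \<in> F" by (simp add: F_def)
    moreover have "Inl u \<in> pe (u, k)" by (simp add: pe_def)
    moreover have "C (pe (u, k)) = k" by (simp add: Cp)
    ultimately show ?thesis by blast
  qed
  \<comment> \<open>This fact serves three times: for positive colors, for the Grundy condition and
    for counting \<open>F\<close>. Edges of \<open>E\<close> get it from greedy domination, pendant
    edges from the greedy edge that caused them.\<close>
  have anchor: "\<exists>m\<in>M. \<exists>u\<in>m. Inl u \<in> f \<and> 1 \<le> C f \<and> C f \<le> c m" if "f \<in> F" for f
    using that unfolding F_def
  proof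
    assume "f \<in> h ` E"
    then obtain e where e: "e \<in> E" "f = h e" by blast
    obtain m u where "m \<in> M" "u \<in> m" "u \<in> e" "c e \<le> c m" using dom[OF e(1)] by blast
    moreover have "Inl u \<in> f" using e(2) \<open>u \<in> e\<close> by (simp add: h_def)
    moreover have "C f = c e" "1 \<le> c e" using e Ch pos by auto
    ultimately show ?thesis by metis
  next
    assume "f \<in> pe ` P"
    then obtain u j where uj: "(u, j) \<in> P" "f = pe (u, j)" by auto
    then obtain m where "m \<in> M" "u \<in> m" "1 \<le> j" "j < c m" by (auto simp: P_def)
    moreover have "Inl u \<in> f" "C f = j" using uj(2) Cp by (auto simp: pe_def)
    ultimately show ?thesis by (metis less_imp_le)
  qed
  \<comment> \<open>A pendant edge avoids the colors of \<open>E\<close> at its attaching vertex by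
    definition of \<open>P\<close>; two distinct pendant edges that meet share this vertex and so
    differ in color.\<close>
  have proper: "C e \<noteq> C f" if F: "e \<in> F" "f \<in> F" and "adjacent e f" for e f
  proof -
    have mixed: "C (h e) \<noteq> C (pe p)" if "e \<in> E" "p \<in> P" "h e \<inter> pe p \<noteq> {}" for e p
      using that Ch Cp by (auto simp: P_def h_def pe_def)
    have hh: "C (h e) \<noteq> C (h f)" if "e \<in> E" "f \<in> E" "h e \<noteq> h f" for e f
      using that Ch cinj by metis
    have pp: "C (pe p) \<noteq> C (pe q)" if "pe p \<noteq> pe q" "pe p \<inter> pe q \<noteq> {}" for p q
      using that Cp by (auto simp: pe_def prod_eq_iff)
    have ef: "e \<noteq> f" "e \<inter> f \<noteq> {}" "f \<inter> e \<noteq> {}"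
      using \<open>adjacent e f\<close> by (auto simp: adjacent_def)
    consider a b where "a \<in> E" "b \<in> E" "e = h a" "f = h b"
      | a q where "a \<in> E" "q \<in> P" "e = h a" "f = pe q"
      | p b where "p \<in> P" "b \<in> E" "e = pe p" "f = h b"
      | p q where "e = pe p" "f = pe q"
      using F unfolding F_def by blast
    then show ?thesis
    proof cases
      case 1 then show ?thesis using hh ef by blast
    next
      case 2 then show ?thesis using mixed ef by blast
    next
      case 3 then show ?thesis using mixed[of b p] ef by simp
    next
      case 4 then show ?thesis using pp ef by blast
    qed
  qed
  have "edge_coloring F C" using anchor by (auto simp: edge_coloring_def)
  then have "proper_edge_coloring F C" using proper by (simp add: proper_edge_coloring_def)
  \<comment> \<open>As \<open>k < C e \<le> c m\<close>, color \<open>k\<close> is present at the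
    vertex \<open>u\<close> of \<open>e\<close>; the edge carrying it differs from \<open>e\<close>
    because its color does.\<close>
  moreover have "\<exists>f\<in>F. adjacent f e \<and> C f = k" if e: "e \<in> F" and k: "1 \<le> k" "k < C e" for e k
  proof -
    obtain m u where m: "m \<in> M" "u \<in> m" "Inl u \<in> e" "C e \<le> c m" using anchor[OF e] by blast
    have "k < c m" using k m by linarith
    then obtain f where "f \<in> F" "Inl u \<in> f" "C f = k" using full[OF m(1,2) k(1)] by blast
    then show ?thesis using m k by (auto simp: adjacent_def)
  qed
  ultimately have "grundy_coloring F C" by (auto simp: grundy_coloring_def)
  moreover have "contains_rainbow_copy W F C V E"
    unfolding contains_rainbow_copy_def
  proof (intro exI conjI)
    show "subgraph (Inl ` V) (h ` E) W F"
      using simple_graph_image[of Inl, OF _ G] unfolding subgraph_def W_def F_def h_def by auto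
    show "isomorphic V E (Inl ` V) (h ` E)"
      unfolding isomorphic_def h_def by (rule exI[of _ Inl]) (auto simp: bij_betw_def)
    show "rainbow_coloring (h ` E) C"
      using rb Ch unfolding rainbow_coloring_def edge_coloring_def by (auto simp: inj_on_def)
  qed
  moreover have "card F \<le> 2 * weight c M"
  proof -
    have "finite F" using \<open>finite E\<close> \<open>finite P\<close> by (simp add: F_def)
    let ?B = "\<lambda>m u. {f\<in>F. Inl u \<in> f \<and> 1 \<le> C f \<and> C f \<le> c m}"
    have B: "card (?B m u) \<le> c m" for m u
    proof -
      have "inj_on C (?B m u)"
      proof (rule inj_onI)
        fix e f assume ef: "e \<in> ?B m u" "f \<in> ?B m u" "C e = C f"
        then have "\<not> adjacent e f" using proper by blast
        then show "e = f" using ef by (auto simp: adjacent_def)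
      qed
      then have "card (?B m u) \<le> card {1..c m}" by (rule card_inj_on_le) auto
      then show ?thesis by simp
    qed
    have "F \<subseteq> (\<Union>m\<in>M. \<Union>u\<in>m. ?B m u)" using anchor by blast
    then have "card F \<le> card (\<Union>m\<in>M. \<Union>u\<in>m. ?B m u)"
      by (rule card_mono[rotated]) (rule finite_subset[OF _ \<open>finite F\<close>], blast)
    also have "\<dots> \<le> (\<Sum>m\<in>M. card (\<Union>u\<in>m. ?B m u))" by (rule card_UN_le[OF \<open>finite M\<close>])
    also have "\<dots> \<le> (\<Sum>m\<in>M. 2 * c m)"
    proof (rule sum_mono)
      fix m assume "m \<in> M"
      then have "card m = 2" using card2 ME by auto
      then have m: "card m = 2" "finite m" by (auto intro: card_ge_0_finite)
      have "card (\<Union>u\<in>m. ?B m u) \<le> (\<Sum>u\<in>m. card (?B m u))" by (rule card_UN_le[OF m(2)])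
      also have "\<dots> \<le> (\<Sum>u\<in>m. c m)" by (rule sum_mono) (rule B)
      also have "\<dots> = 2 * c m" using m by simp
      finally show "card (\<Union>u\<in>m. ?B m u) \<le> 2 * c m" .
    qed
    also have "\<dots> = 2 * weight c M" by (simp add: weight_def sum_distrib_left)
    finally show ?thesis .
  qed
  ultimately show ?thesis using W by blast
qed

section \<open>Upper bound on \<open>w_greedy\<close> by the vertex cover number\<close>

text \<open>Color by decreasing \<open>g\<close> and exchange the sums: an edge \<open>f\<close> is
  counted once for each matched \<open>e\<close> with \<open>g e \<le> g f\<close>. These
  \<open>e\<close> have distinct labels in \<open>{1..g f}\<close>, so there are at most
  \<open>g f\<close> of them.\<close>

lemma w_greedy_le_sum:
  assumes "finite E" and pos: "\<forall>e\<in>E. 1 \<le> g e"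
    and inj: "\<And>M. matching E M \<Longrightarrow> inj_on g M"
  shows "w_greedy E \<le> (\<Sum>e\<in>E. g e)"
proof -
  obtain c where c: "rainbow_coloring E c" "\<forall>e\<in>E. c e \<le> card {f\<in>E. g e \<le> g f}"
    using rainbow_coloring_le_ex[OF assms(1), of g] by blast
  obtain M where M: "greedy_matching E c M" using greedy_matching_ex[OF assms(1)] by blast
  then have mM: "matching E M" by (auto simp: greedy_matching_def intro: greedy_picked_matching)
  have ME: "M \<subseteq> E" using mM by (simp add: matching_def)
  have "finite M" using ME assms(1) finite_subset by blast
  have "w_greedy E \<le> weight c M"
    unfolding w_greedy_def by (rule Least_le) (use c M in blast)
  also have "\<dots> \<le> (\<Sum>e\<in>M. card {f\<in>E. g e \<le> g f})"
    unfolding weight_def by (rule sum_mono) (use c ME in auto)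
  also have "\<dots> = (\<Sum>f\<in>E. card {e\<in>M. g e \<le> g f})"
    by (rule sum_multicount_gen) (use assms(1) \<open>finite M\<close> in auto)
  also have "\<dots> \<le> (\<Sum>f\<in>E. g f)"
  proof (rule sum_mono)
    fix f
    have "inj_on g {e\<in>M. g e \<le> g f}" using inj[OF mM] by (rule inj_on_subset) auto
    then have "card {e\<in>M. g e \<le> g f} \<le> card {1..g f}"
      by (rule card_inj_on_le) (use pos ME in auto)
    then show "card {e\<in>M. g e \<le> g f} \<le> g f" by simp
  qed
  finally show ?thesis .
qed

lemma w_greedy_le_vertex_cover_number:
  assumes G: "simple_graph V E"
  shows "2 * w_greedy E \<le> (vertex_cover_number V E + 1) * card E"
proof -
  have "finite V" and EV: "\<And>e. e \<in> E \<Longrightarrow> e \<subseteq> V" and card2: "\<And>e. e \<in> E \<Longrightarrow> card e = 2"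
    using G by (auto simp: simple_graph_def)
  have "finite E" using G by (rule simple_graph_finite_edges)
  have "vertex_cover V E V" 
    unfolding vertex_cover_def
  proof (intro conjI ballI)
    fix e assume "e \<in> E"
    then have "V \<inter> e = e" "card e = 2" using EV card2 by auto
    then show "V \<inter> e \<noteq> {}" by auto
  qed simp
  then have "\<exists>n S. vertex_cover V E S \<and> card S = n" by blast
  then have "\<exists>S. vertex_cover V E S \<and> card S = vertex_cover_number V E"
    unfolding vertex_cover_number_def by (rule LeastI_ex)
  then obtain S where S: "vertex_cover V E S" "card S = vertex_cover_number V E" by blast
  let ?t = "vertex_cover_number V E"
  have "finite S" using S(1) \<open>finite V\<close> finite_subset by (auto simp: vertex_cover_def)
  then obtain n where n: "bij_betw n S {1..?t}"
    using S(2) finite_same_card_bij[of S "{1..?t}"] by auto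
  define s where "s e = (SOME x. x \<in> S \<inter> e)" for e
  have s: "s e \<in> S \<inter> e" if "e \<in> E" for e
  proof -
    have "\<exists>x. x \<in> S \<inter> e" using S(1) that by (auto simp: vertex_cover_def)
    then show ?thesis unfolding s_def by (rule someI_ex)
  qed
  \<comment> \<open>Edges with equal label contain the same cover vertex, hence the labels are
    distinct on every matching.\<close>
  define g where "g e = n (s e)" for e
  have g: "1 \<le> g e" "g e \<le> ?t" if "e \<in> E" for e
    using bij_betwE[OF n] s[OF that] by (auto simp: g_def)
  have inj: "inj_on g M" if M: "matching E M" for M
  proof (rule inj_onI)
    fix e f assume ef: "e \<in> M" "f \<in> M" "g e = g f"
    have "e \<in> E" "f \<in> E" using M ef by (auto simp: matching_def)
    then have "s e = s f"
      using s ef(3) n unfolding g_def bij_betw_def by (meson IntD1 inj_onD)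
    then have "e \<inter> f \<noteq> {}" using s[OF \<open>e \<in> E\<close>] s[OF \<open>f \<in> E\<close>] by auto
    then show "e = f" using M ef by (auto simp: matching_def adjacent_def)
  qed
  have 1: "w_greedy E \<le> (\<Sum>e\<in>E. g e)"
    by (rule w_greedy_le_sum) (use \<open>finite E\<close> g inj in auto)
  \<comment> \<open>The reversed labels again lie in \<open>{1..?t}\<close> and stay distinct on
    matchings; \<open>g e \<le> ?t\<close> keeps the natural-number subtraction exact.\<close>
  have 2: "w_greedy E \<le> (\<Sum>e\<in>E. ?t + 1 - g e)"
  proof (rule w_greedy_le_sum)
    show "inj_on (\<lambda>e. ?t + 1 - g e) M" if M: "matching E M" for M
    proof (rule inj_onI)
      fix e f assume ef: "e \<in> M" "f \<in> M" "?t + 1 - g e = ?t + 1 - g f"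
      then have "e \<in> E" "f \<in> E" using M by (auto simp: matching_def)
      then have "g e = g f" using g(2)[of e] g(2)[of f] ef(3) by linarith
      then show "e = f" using inj[OF M] ef by (simp add: inj_on_def)
    qed
  qed (use \<open>finite E\<close> g in \<open>auto simp: Suc_le_eq less_Suc_eq_le\<close>)
  \<comment> \<open>Both sums are at least \<open>w_greedy E\<close>, and each edge contributes
    \<open>?t + 1\<close> to their total.\<close>
  have "(\<Sum>e\<in>E. g e) + (\<Sum>e\<in>E. ?t + 1 - g e) = (\<Sum>e\<in>E. ?t + 1)"
    unfolding sum.distrib[symmetric] by (rule sum.cong) (use g(2) in \<open>auto simp: le_SucI\<close>)
  also have "\<dots> = (?t + 1) * card E" by simp
  finally show ?thesis using 1 2 by linarith
qed

theorem lemma11: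
  fixes V :: "'a set" and E :: "'a set set" and k \<chi>' \<tau> :: nat
  assumes "simple_graph V E"
    and "no_isolated_vertices V E"
    and "k = card E" and "1 \<le> k"
    and "\<chi>' = chromatic_index E"
    and "\<tau> = vertex_cover_number V E"
  shows "real k ^ 2 / (4 * real \<chi>') \<le> real (w_max E) / 2 \<and>
    real (w_max E) / 2 \<le> real (AR_FF V E) \<and>
    real (AR_FF V E) \<le> 2 * real (w_greedy E) \<and>
    2 * real (w_greedy E) \<le> (real \<tau> + 1) * real k"
proof -
  have "finite E" using \<open>1 \<le> k\<close> \<open>k = card E\<close> by (intro card_ge_0_finite) simp
  have "k\<^sup>2 \<le> 2 * \<chi>' * w_max E"
    using card_squared_le_chromatic_index_w_max[OF \<open>finite E\<close>] assms by simp
  then have "real (k\<^sup>2) \<le> real (2 * \<chi>' * w_max E)" by (rule of_nat_mono)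
  \<comment> \<open>Clearing the denominator needs a positive \<open>\<chi>'\<close>; the value 0
    would force \<open>k = 0\<close>.\<close>
  moreover from this have "0 < \<chi>'" using \<open>1 \<le> k\<close> by (cases \<chi>') auto
  ultimately have 1: "real k ^ 2 / (4 * real \<chi>') \<le> real (w_max E) / 2"
    by (simp add: field_simps)
  obtain c M where cM: "rainbow_coloring E c" "greedy_matching E c M" "w_greedy E = weight c M"
    using w_greedy_attained[OF \<open>finite E\<close>] by blast
  obtain W :: "('a + 'a \<times> nat) set" and F C where W: "simple_graph W F" "grundy_coloring F C"
    "contains_rainbow_copy W F C V E" and card: "card F \<le> 2 * w_greedy E"
    using grundy_extension_ex[OF assms(1) cM(1,2)] cM(3) by metis
  have 3: "AR_FF V E \<le> 2 * w_greedy E" using AR_FF_le_grundy(1)[OF W] card by linarith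
  \<comment> \<open>The bound for arbitrary presentations is applied to one of length
    \<open>AR_FF V E\<close>, which exists by the attainment claim.\<close>
  have 2: "w_max E \<le> 2 * AR_FF V E"
    using AR_FF_le_grundy(2)[OF W] w_max_le_first_fit[OF assms(1)] by metis
  have "2 * w_greedy E \<le> (\<tau> + 1) * k"
    using w_greedy_le_vertex_cover_number[OF assms(1)] assms by simp
  then have "real (2 * w_greedy E) \<le> real ((\<tau> + 1) * k)" by (rule of_nat_mono)
  then have 4: "2 * real (w_greedy E) \<le> (real \<tau> + 1) * real k" by (simp add: algebra_simps)
  show ?thesis using 1 2 3 4 by linarith
qed

end
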